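(* For any $\theta\in\Theta$, $H\in(1/2,1)$ and $n\in\mathbb N$ (for which the inverse matrices involved exist), the matrix $M(\theta,H;n)-M^H(\theta,H;n)$ is positive semidefinite or, what is equivalent, $(M(\theta,H;n))^{-1}-(M^H(\theta,H;n))^{-1}$ is negative semidefinite. Here, with $A:=\oplus_{k=1}^n\nabla_\theta\bar X^\theta_{t^n_k}$ and $\Xi:=\Xi^{\theta,H}_{(n)}$, $$M(\theta,H;n)=(A^TA)^{-1}(A^T\,\Xi\,A)(A^TA)^{-1}$$ is the limiting variance of the trajectory-fitting estimator, and $$M^H(\theta,H;n)=(A^T\Xi^{-1}A)^{-1}(A^T\Xi^{-1}\,\Xi\,\Xi^{-1}A)(A^T\Xi^{-1}A)^{-1}=(A^T\Xi^{-1}A)^{-1}$$ is the limiting variance of the minimum contrast estimator with parameter $\mathcal H=H$.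
   Context: Fix $T>0$ and integers $1\le m<d$, $\tilde m\ge1$; $\mathcal X=\mathbb R^m$, $\mathcal Y=\mathbb R^{d-m}$. $\Theta$ is an open, bounded, convex subset of a Euclidean space. Given are coefficients $c_\theta:\mathcal X\times\mathcal Y\to\mathbb R^m$ ($\theta\in\Theta$), $\sigma:\mathcal Y\to\mathbb R^{m\times\tilde m}$, $f$ and $\tau$ on $\mathcal Y$, an initial point $x_0\in\mathcal X$ and $\lambda\in[0,\infty)$, satisfying: On $c_\theta$: there are $K,q>0$ and $r\in[0,1)$ with $|c_\theta(x,y)|\le K(1+|x|^r)(1+|y|^q)$ for all $\theta\in\Theta$; there are $K,q>0$ with $|\nabla_xc_\theta(x,y)|+|\nabla_x\nabla_xc_\theta(x,y)|\le K(1+|y|^q)$ for all $\theta\in\Theta$; $c$, $\nabla_xc$, $\nabla_x\nabla_xc$ and $\nabla_y\nabla_yc$ are continuous in $(\theta,x,y)$; $c$, $\nabla_xc$, $\nabla_x\nabla_xc$ are Hölder continuous in $y$ uniformly in $(\theta,x)$; $c$ has two locally bounded derivatives in $\theta$ with at most polynomial growth in $x$ and $y$. On $\sigma$: there are $K,q>0$ with $|\sigma(y)|\le K(1+|y|^q)$; $\sigma\sigma^T$ is uniformly nondegenerate. On $f,\tau$: $f$ and $\tau\tau^T$ are twice differentiable and, along with their first and second derivatives, Hölder continuous; $\tau\tau^T$ is uniformly bounded and uniformly nondegenerate; $\lim_{|y|\to\infty}y\cdot f(y)=-\infty$. $\mu$ is the unique invariant probability measure on $\mathcal Y$ of $\mathcal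 L=f\cdot\nabla_y+\frac12(\tau\tau^T):\nabla_y^2$; $\bar c_\theta(x):=\int_{\mathcal Y}c_\theta(x,y)\mu(dy)$, $\bar\sigma:=\int_{\mathcal Y}\sigma(y)\mu(dy)$. $\bar X^\theta$ is the deterministic solution of $\bar X^\theta_t=x_0+\int_0^t\bar c_\theta(\bar X^\theta_s)ds$, $t\in[0,T]$, and $\nabla_\theta\bar X^\theta_t$ is the Jacobian matrix of $\theta\mapsto\bar X^\theta_t$. $t^n_k:=Tk/n$. $\Phi_\theta(x,y)$ is the unique solution, in the class of functions growing at most polynomially in $|y|$, of $\mathcal L\Phi_\theta(x,y)=-(c_\theta(x,y)-\bar c_\theta(x))$, $\int_{\mathcal Y}\Phi_\theta(x,y)\mu(dy)=0$; $\Sigma^\theta_\Phi(x):=\left(\int_{\mathcal Y}(\nabla_y\Phi_\theta\tau)(\nabla_y\Phi_\theta\tau)^T(x,y)\mu(dy)\right)^{1/2}$. For $0\le s\le t\le T$, $Z^\theta(t,s)$ is the $m\times m$ matrix solution of $\frac{d}{dt}Z^\theta(t,s)=(\nabla_x\bar c_\theta)(\bar X^\theta_t)Z^\theta(t,s)$, $Z^\theta(s,s)=I_m$. The Gaussian process $\xi^{\theta,H}$ is $$\xi^{\theta,H}_t=\lambda\int_0^tZ^\theta(t,s)\Sigma^\theta_\Phi(\bar X^\theta_s)d\tilde B_s+\int_0^tZ^\theta(t,s)\bar\sigma\,d\tilde W^H_s,$$ with $\tilde W^H$ an $\tilde m$-dimensional fractional Brownian motion of Hurst index $H$ and $\tilde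 B$ an independent standard Brownian motion. $\oplus_{k=1}^n$ denotes vertical concatenation (stacking) of vectors or matrices; $\xi^{\theta,H}_{(n)}:=\oplus_{k=1}^n\xi^{\theta,H}_{t^n_k}\in\mathbb R^{nm}$ and $\Xi^{\theta,H}_{(n)}:=E[\xi^{\theta,H}_{(n)}(\xi^{\theta,H}_{(n)})^T]$. *)

theory Defs
  imports "HOL-Probability.Probability"
begin

section \<open>Derivatives and regularity\<close>

text \<open>
  The derivative as an element of the normed space of bounded linear maps, so that it can be
  iterated: the second derivative is \<open>nabla (nabla g) x u v\<close>. As with
  \<^const>\<open>frechet_derivative\<close>, it is meaningful only where \<open>g\<close> is differentiable.
\<close>

definition nabla ::
  "('a::real_normed_vector \<Rightarrow> 'b::real_normed_vector) \<Rightarrow> 'a \<Rightarrow> 'a \<Rightarrow>\<^sub>L 'b" where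
  "nabla g x = Blinfun (frechet_derivative g (at x))"

definition twice_differentiable_at ::
  "('a::real_normed_vector \<Rightarrow> 'b::real_normed_vector) \<Rightarrow> 'a \<Rightarrow> bool" where
  "twice_differentiable_at g x \<longleftrightarrow>
     (\<forall>\<^sub>F z in nhds x. g differentiable (at z)) \<and> nabla g differentiable (at x)"

definition C2 :: "('a::real_normed_vector \<Rightarrow> 'b::real_normed_vector) \<Rightarrow> bool" where
  "C2 g \<longleftrightarrow> (\<forall>x. twice_differentiable_at g x) \<and> continuous_on UNIV (nabla (nabla g))"

definition holder_uniformly ::
  "'i set \<Rightarrow> ('i \<Rightarrow> 'a::real_normed_vector \<Rightarrow> 'b::real_normed_vector) \<Rightarrow> bool" where
  "holder_uniformly S g \<longleftrightarrow>
     (\<exists>K \<alpha>. 0 < K \<and> 0 < \<alpha> \<and> \<alpha> \<le> 1 \<and>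
        (\<forall>i\<in>S. \<forall>y z. norm (g i y - g i z) \<le> K * norm (y - z) powr \<alpha>))"

definition holder :: "('a::real_normed_vector \<Rightarrow> 'b::real_normed_vector) \<Rightarrow> bool" where
  "holder g \<longleftrightarrow> holder_uniformly UNIV (\<lambda>_::unit. g)"

section \<open>Matrices\<close>

definition sym_matrix :: "real^'n^'n \<Rightarrow> bool" where
  "sym_matrix P \<longleftrightarrow> transpose P = P"

definition pos_semidef :: "real^'n^'n \<Rightarrow> bool" where
  "pos_semidef P \<longleftrightarrow> sym_matrix P \<and> (\<forall>v. 0 \<le> v \<bullet> (P *v v))"

definition neg_semidef :: "real^'n^'n \<Rightarrow> bool" where
  "neg_semidef P \<longleftrightarrow> sym_matrix P \<and> (\<forall>v. v \<bullet> (P *v v) \<le> 0)"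

definition matrix_sqrt :: "real^'n^'n \<Rightarrow> real^'n^'n" where
  "matrix_sqrt S = (THE R. pos_semidef R \<and> R ** R = S)"

definition uniformly_nondegenerate :: "('y \<Rightarrow> real^'n^'n) \<Rightarrow> bool" where
  "uniformly_nondegenerate a \<longleftrightarrow> (\<exists>\<kappa>>0. \<forall>y v. \<kappa> * (norm v)\<^sup>2 \<le> v \<bullet> (a y *v v))"

text \<open>The matrix \<open>u v\<^sup>T\<close>.\<close>

definition outer :: "real^'m \<Rightarrow> real^'n \<Rightarrow> real^'n^'m" where
  "outer u v = (\<chi> i j. u $ i * v $ j)"

text \<open>
  Vertical concatenation of \<open>F 1, \<dots>, F n\<close>. The blocks are addressed by a finite type \<open>'k\<close> that
  is numbered from \<open>1\<close> to \<open>n\<close> by a bijection \<open>label\<close>; a row of the result is addressed by a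
  block together with a row of that block. With \<open>'a = real\<close> this stacks vectors, with
  \<open>'a = real^'p\<close> it stacks matrices with columns indexed by \<open>'p\<close>.
\<close>

definition stack :: "('k \<Rightarrow> nat) \<Rightarrow> (nat \<Rightarrow> 'a^'m) \<Rightarrow> 'a^('k::finite \<times> 'm)" where
  "stack label F = (\<chi> r. F (label (fst r)) $ snd r)"

section \<open>Assumptions on the coefficients\<close>

definition drift_assumptions ::
  "(real^'p) set \<Rightarrow> (real^'p \<Rightarrow> real^'m \<Rightarrow> real^'y \<Rightarrow> real^'m) \<Rightarrow> bool" where
  "drift_assumptions \<Theta> c \<longleftrightarrow>
     (\<exists>K q r. 0 < K \<and> 0 < q \<and> 0 \<le> r \<and> r < 1 \<and>
        (\<forall>\<theta>\<in>\<Theta>. \<forall>x y. norm (c \<theta> x y) \<le> K * (1 + norm x powr r) * (1 + norm y powr q))) \<and>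
     (\<forall>\<theta>\<in>\<Theta>. \<forall>x y. twice_differentiable_at (\<lambda>x. c \<theta> x y) x) \<and>
     (\<forall>\<theta>\<in>\<Theta>. \<forall>x y. twice_differentiable_at (c \<theta> x) y) \<and>
     (\<forall>\<theta>\<in>\<Theta>. \<forall>x y. twice_differentiable_at (\<lambda>\<theta>. c \<theta> x y) \<theta>) \<and>
     (\<exists>K q. 0 < K \<and> 0 < q \<and>
        (\<forall>\<theta>\<in>\<Theta>. \<forall>x y.
           norm (nabla (\<lambda>x. c \<theta> x y) x) + norm (nabla (nabla (\<lambda>x. c \<theta> x y)) x)
             \<le> K * (1 + norm y powr q))) \<and>
     continuous_on (\<Theta> \<times> UNIV \<times> UNIV) (\<lambda>(\<theta>, x, y). c \<theta> x y) \<and>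
     continuous_on (\<Theta> \<times> UNIV \<times> UNIV) (\<lambda>(\<theta>, x, y). nabla (\<lambda>x. c \<theta> x y) x) \<and>
     continuous_on (\<Theta> \<times> UNIV \<times> UNIV) (\<lambda>(\<theta>, x, y). nabla (nabla (\<lambda>x. c \<theta> x y)) x) \<and>
     continuous_on (\<Theta> \<times> UNIV \<times> UNIV) (\<lambda>(\<theta>, x, y). nabla (nabla (c \<theta> x)) y) \<and>
     holder_uniformly (\<Theta> \<times> UNIV) (\<lambda>(\<theta>, x) y. c \<theta> x y) \<and>
     holder_uniformly (\<Theta> \<times> UNIV) (\<lambda>(\<theta>, x) y. nabla (\<lambda>x. c \<theta> x y) x) \<and>
     holder_uniformly (\<Theta> \<times> UNIV) (\<lambda>(\<theta>, x) y. nabla (nabla (\<lambda>x. c \<theta> x y)) x) \<and>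
     (\<forall>C. compact C \<and> C \<subseteq> \<Theta> \<longrightarrow>
        (\<exists>K q. 0 < K \<and> 0 < q \<and>
           (\<forall>\<theta>\<in>C. \<forall>x y.
              norm (nabla (\<lambda>\<theta>. c \<theta> x y) \<theta>) + norm (nabla (nabla (\<lambda>\<theta>. c \<theta> x y)) \<theta>)
                \<le> K * (1 + norm x powr q) * (1 + norm y powr q))))"

definition sigma_assumptions :: "(real^'y \<Rightarrow> real^'w^'m) \<Rightarrow> bool" where
  "sigma_assumptions \<sigma> \<longleftrightarrow>
     \<sigma> \<in> borel_measurable borel \<and>
     (\<exists>K q. 0 < K \<and> 0 < q \<and> (\<forall>y. norm (\<sigma> y) \<le> K * (1 + norm y powr q))) \<and>
     uniformly_nondegenerate (\<lambda>y. \<sigma> y ** transpose (\<sigma> y))"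

definition fast_assumptions ::
  "(real^'y \<Rightarrow> real^'y) \<Rightarrow> (real^'y \<Rightarrow> real^'l^'y) \<Rightarrow> bool" where
  "fast_assumptions f \<tau> \<longleftrightarrow>
     (let a = (\<lambda>y. \<tau> y ** transpose (\<tau> y)) in
        (\<forall>y. twice_differentiable_at f y) \<and> (\<forall>y. twice_differentiable_at a y) \<and>
        holder f \<and> holder (nabla f) \<and> holder (nabla (nabla f)) \<and>
        holder a \<and> holder (nabla a) \<and> holder (nabla (nabla a)) \<and>
        bounded (range a) \<and> uniformly_nondegenerate a \<and>
        (LIM y at_infinity. y \<bullet> f y :> at_bot))"

section \<open>The averaged dynamics\<close>

definition generator ::
  "(real^'y \<Rightarrow> real^'y) \<Rightarrow> (real^'y \<Rightarrow> real^'l^'y) \<Rightarrow>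
    (real^'y \<Rightarrow> 'b::real_normed_vector) \<Rightarrow> real^'y \<Rightarrow> 'b" where
  "generator f \<tau> g y =
     blinfun_apply (nabla g y) (f y) +
     (1/2) *\<^sub>R (\<Sum>i\<in>UNIV. \<Sum>j\<in>UNIV. (\<tau> y ** transpose (\<tau> y)) $ i $ j *\<^sub>R
        blinfun_apply (blinfun_apply (nabla (nabla g) y) (axis i 1)) (axis j 1))"

text \<open>Invariance of a measure for the operator \<open>\<L>\<close>, i.e. \<open>\<L>\<^sup>* \<mu> = 0\<close> in the weak sense.\<close>

definition invariant_prob ::
  "(real^'y \<Rightarrow> real^'y) \<Rightarrow> (real^'y \<Rightarrow> real^'l^'y) \<Rightarrow> (real^'y) measure \<Rightarrow> bool" where
  "invariant_prob f \<tau> \<mu> \<longleftrightarrow>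
     prob_space \<mu> \<and> sets \<mu> = sets borel \<and>
     (\<forall>\<phi> :: real^'y \<Rightarrow> real. C2 \<phi> \<and> bounded {y. \<phi> y \<noteq> 0} \<longrightarrow>
        has_bochner_integral \<mu> (generator f \<tau> \<phi>) 0)"

definition c_bar ::
  "(real^'y) measure \<Rightarrow> (real^'p \<Rightarrow> real^'m \<Rightarrow> real^'y \<Rightarrow> real^'m) \<Rightarrow>
    real^'p \<Rightarrow> real^'m \<Rightarrow> real^'m" where
  "c_bar \<mu> c \<theta> x = (\<integral>y. c \<theta> x y \<partial>\<mu>)"

definition sigma_bar :: "(real^'y) measure \<Rightarrow> (real^'y \<Rightarrow> real^'w^'m) \<Rightarrow> real^'w^'m" where
  "sigma_bar \<mu> \<sigma> = (\<integral>y. \<sigma> y \<partial>\<mu>)"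

definition integral_solution ::
  "real \<Rightarrow> ('a::euclidean_space \<Rightarrow> 'a) \<Rightarrow> 'a \<Rightarrow> (real \<Rightarrow> 'a) \<Rightarrow> bool" where
  "integral_solution T b x\<^sub>0 X \<longleftrightarrow>
     (\<forall>t\<in>{0..T}. ((\<lambda>s. b (X s)) has_integral (X t - x\<^sub>0)) {0..t})"

definition poisson_solution ::
  "(real^'y \<Rightarrow> real^'y) \<Rightarrow> (real^'y \<Rightarrow> real^'l^'y) \<Rightarrow> (real^'y) measure \<Rightarrow>
    (real^'y \<Rightarrow> real^'m) \<Rightarrow> (real^'y \<Rightarrow> real^'m) \<Rightarrow> bool" where
  "poisson_solution f \<tau> \<mu> h \<Phi> \<longleftrightarrow>
     C2 \<Phi> \<and>
     (\<exists>K q. 0 < K \<and> 0 < q \<and> (\<forall>y. norm (\<Phi> y) \<le> K * (1 + norm y powr q))) \<and>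
     (\<forall>y. generator f \<tau> \<Phi> y = - h y) \<and>
     has_bochner_integral \<mu> \<Phi> 0"

definition Sigma_Phi ::
  "(real^'y) measure \<Rightarrow> (real^'y \<Rightarrow> real^'l^'y) \<Rightarrow> (real^'m \<Rightarrow> real^'y \<Rightarrow> real^'m) \<Rightarrow>
    real^'m \<Rightarrow> real^'m^'m" where
  "Sigma_Phi \<mu> \<tau> \<Phi> x =
     matrix_sqrt
       (\<integral>y. (jacobian (\<Phi> x) (at y) ** \<tau> y) ** transpose (jacobian (\<Phi> x) (at y) ** \<tau> y) \<partial>\<mu>)"

definition fundamental_matrix ::
  "real \<Rightarrow> (real^'m \<Rightarrow> real^'m) \<Rightarrow> (real \<Rightarrow> real^'m) \<Rightarrow> (real \<Rightarrow> real \<Rightarrow> real^'m^'m) \<Rightarrow> bool" where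
  "fundamental_matrix T b X Z \<longleftrightarrow>
     (\<forall>s\<in>{0..T}. Z s s = mat 1 \<and>
        (\<forall>t\<in>{s..T}. ((\<lambda>t. Z t s) has_vector_derivative jacobian b (at (X t)) ** Z t s)
           (at t within {s..T})))"

section \<open>Gaussian processes and Wiener integrals\<close>

text \<open>Normal random variables, constants (variance zero) included.\<close>

definition normal_rv :: "'w measure \<Rightarrow> ('w \<Rightarrow> real) \<Rightarrow> bool" where
  "normal_rv M X \<longleftrightarrow>
     X \<in> borel_measurable M \<and>
     ((\<exists>a. AE \<omega> in M. X \<omega> = a) \<or>
      (\<exists>a s. 0 < s \<and> distributed M lborel X (\<lambda>x. ennreal (normal_density a s x))))"

text \<open>
  Centred, with continuous paths, jointly Gaussian, and with independent, identically
  distributed components that have covariance function \<open>R\<close>.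
\<close>

definition gaussian_process ::
  "'w measure \<Rightarrow> real \<Rightarrow> (real \<Rightarrow> real \<Rightarrow> real) \<Rightarrow> (real \<Rightarrow> 'w \<Rightarrow> real^'k) \<Rightarrow> bool" where
  "gaussian_process M T R X \<longleftrightarrow>
     (\<forall>t\<in>{0..T}. X t \<in> borel_measurable M) \<and>
     (\<forall>S v. finite S \<and> S \<subseteq> {0..T} \<longrightarrow> normal_rv M (\<lambda>\<omega>. \<Sum>t\<in>S. v t \<bullet> X t \<omega>)) \<and>
     (\<forall>t\<in>{0..T}. (\<integral>\<omega>. X t \<omega> \<partial>M) = 0) \<and>
     (\<forall>s\<in>{0..T}. \<forall>t\<in>{0..T}. (\<integral>\<omega>. outer (X s \<omega>) (X t \<omega>) \<partial>M) = mat (R s t)) \<and>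
     (AE \<omega> in M. continuous_on {0..T} (\<lambda>t. X t \<omega>))"

definition brownian_motion ::
  "'w measure \<Rightarrow> real \<Rightarrow> (real \<Rightarrow> 'w \<Rightarrow> real^'k) \<Rightarrow> bool" where
  "brownian_motion M T B \<longleftrightarrow> gaussian_process M T min B"

definition fractional_brownian_motion ::
  "'w measure \<Rightarrow> real \<Rightarrow> real \<Rightarrow> (real \<Rightarrow> 'w \<Rightarrow> real^'k) \<Rightarrow> bool" where
  "fractional_brownian_motion M T H W \<longleftrightarrow>
     gaussian_process M T
       (\<lambda>s t. (s powr (2*H) + t powr (2*H) - \<bar>t - s\<bar> powr (2*H)) / 2) W"

text \<open>The \<open>\<sigma>\<close>-algebra generated by the variables \<open>X t\<close>, \<open>t \<in> [0, T]\<close>.\<close>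

definition generated_events ::
  "'w measure \<Rightarrow> real \<Rightarrow> (real \<Rightarrow> 'w \<Rightarrow> real^'k) \<Rightarrow> 'w set set" where
  "generated_events M T X =
     sigma_sets (space M) {X t -` S \<inter> space M | t S. t \<in> {0..T} \<and> S \<in> sets borel}"

definition independent_processes ::
  "'w measure \<Rightarrow> real \<Rightarrow> (real \<Rightarrow> 'w \<Rightarrow> real^'k) \<Rightarrow> (real \<Rightarrow> 'w \<Rightarrow> real^'l) \<Rightarrow> bool" where
  "independent_processes M T X Y \<longleftrightarrow>
     prob_space.indep_set M (generated_events M T X) (generated_events M T Y)"

definition partition_points :: "real \<Rightarrow> nat \<Rightarrow> (nat \<Rightarrow> real) \<Rightarrow> bool" where
  "partition_points t N u \<longleftrightarrow> u 0 = 0 \<and> u N = t \<and> (\<forall>k<N. u k \<le> u (Suc k))"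

definition step_function ::
  "nat \<Rightarrow> (nat \<Rightarrow> real) \<Rightarrow> (nat \<Rightarrow> real^'k^'m) \<Rightarrow> real \<Rightarrow> real^'k^'m" where
  "step_function N u g s = (\<Sum>k<N. indicat_real {u k<..u (Suc k)} s *\<^sub>R g k)"

definition step_integral ::
  "nat \<Rightarrow> (nat \<Rightarrow> real) \<Rightarrow> (nat \<Rightarrow> real^'k^'m) \<Rightarrow> (real \<Rightarrow> 'w \<Rightarrow> real^'k) \<Rightarrow> 'w \<Rightarrow> real^'m" where
  "step_integral N u g W \<omega> = (\<Sum>k<N. g k *v (W (u (Suc k)) \<omega> - W (u k) \<omega>))"

text \<open>
  \<open>I\<close> is (a version of) the integral of the deterministic matrix function \<open>G\<close> over \<open>[0, t]\<close>
  against \<open>W\<close>: the limit in mean square of the integrals of step functions that converge to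
  \<open>G\<close> in \<open>L\<^sup>2[0, t]\<close>. For Brownian motion this is the Ito isometry construction. For fractional
  Brownian motion with Hurst index \<open>H > 1/2\<close>, the norm
  \<open>H (2H - 1) \<integral>\<integral> \<bar>G u\<bar> \<bar>G v\<bar> \<bar>u - v\<bar> powr (2H - 2) du dv\<close> is dominated by the \<open>L\<^sup>2[0, t]\<close> norm, so
  the limit exists for every \<open>G\<close> in \<open>L\<^sup>2[0, t]\<close> and does not depend on the approximation.
\<close>

definition has_wiener_integral ::
  "'w measure \<Rightarrow> (real \<Rightarrow> 'w \<Rightarrow> real^'k) \<Rightarrow> real \<Rightarrow> (real \<Rightarrow> real^'k^'m) \<Rightarrow> ('w \<Rightarrow> real^'m) \<Rightarrow> bool"
  where
  "has_wiener_integral M W t G I \<longleftrightarrow>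
     set_borel_measurable lborel {0..t} G \<and> I \<in> borel_measurable M \<and>
     (\<exists>N u g. (\<forall>j. partition_points t (N j) (u j)) \<and>
        (\<lambda>j. \<integral>\<^sup>+s\<in>{0..t}. ennreal ((norm (step_function (N j) (u j) (g j) s - G s))\<^sup>2) \<partial>lborel)
          \<longlonglongrightarrow> 0 \<and>
        (\<lambda>j. \<integral>\<^sup>+\<omega>. ennreal ((norm (step_integral (N j) (u j) (g j) W \<omega> - I \<omega>))\<^sup>2) \<partial>M)
          \<longlonglongrightarrow> 0)"

definition limit_process ::
  "'w measure \<Rightarrow> real \<Rightarrow> real \<Rightarrow> (real \<Rightarrow> 'w \<Rightarrow> real^'m) \<Rightarrow> (real \<Rightarrow> 'w \<Rightarrow> real^'v) \<Rightarrow>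
    (real \<Rightarrow> real \<Rightarrow> real^'m^'m) \<Rightarrow> (real \<Rightarrow> real^'m^'m) \<Rightarrow> real^'v^'m \<Rightarrow>
    (real \<Rightarrow> 'w \<Rightarrow> real^'m) \<Rightarrow> bool" where
  "limit_process M T lam B W Z S sbar \<xi> \<longleftrightarrow>
     (\<forall>t\<in>{0..T}. \<xi> t \<in> borel_measurable M \<and>
        (\<exists>I J. has_wiener_integral M B t (\<lambda>s. Z t s ** S s) I \<and>
               has_wiener_integral M W t (\<lambda>s. Z t s ** sbar) J \<and>
               (AE \<omega> in M. \<xi> t \<omega> = lam *\<^sub>R I \<omega> + J \<omega>)))"

section \<open>Limiting variances of the estimators\<close>

definition second_moment_matrix :: "'w measure \<Rightarrow> ('w \<Rightarrow> real^'n) \<Rightarrow> real^'n^'n" where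
  "second_moment_matrix M X = (\<integral>\<omega>. outer (X \<omega>) (X \<omega>) \<partial>M)"

definition trajectory_fitting_variance :: "real^'p^'n \<Rightarrow> real^'n^'n \<Rightarrow> real^'p^'p" where
  "trajectory_fitting_variance A \<Xi> =
     matrix_inv (transpose A ** A) ** (transpose A ** \<Xi> ** A) ** matrix_inv (transpose A ** A)"

text \<open>\<open>\<Psi>\<close> is the covariance matrix used in the contrast, \<open>\<Xi>\<close> the actual one.\<close>

definition minimum_contrast_variance ::
  "real^'p^'n \<Rightarrow> real^'n^'n \<Rightarrow> real^'n^'n \<Rightarrow> real^'p^'p" where
  "minimum_contrast_variance A \<Psi> \<Xi> =
     matrix_inv (transpose A ** matrix_inv \<Psi> ** A) **
     (transpose A ** matrix_inv \<Psi> ** \<Xi> ** matrix_inv \<Psi> ** A) **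
     matrix_inv (transpose A ** matrix_inv \<Psi> ** A)"

end

theory Submission
  imports Defs
begin

text \<open>
  As a second moment matrix, \<open>\<Xi>\<close> is positive semidefinite, and the theorem is an instance of the
  Gauss--Markov argument: both differences (the second one with reversed sign) are congruences
  \<open>N \<Xi> N\<^sup>T\<close>. For the variances, \<open>N\<close> is the difference of the two linear estimators,
  \<open>(A\<^sup>T A)\<^sup>-\<^sup>1 A\<^sup>T - (A\<^sup>T \<Xi>\<^sup>-\<^sup>1 A)\<^sup>-\<^sup>1 A\<^sup>T \<Xi>\<^sup>-\<^sup>1\<close>; for their inverses,
  \<open>N = A\<^sup>T \<Xi>\<^sup>-\<^sup>1 - (A\<^sup>T A) (A\<^sup>T \<Xi> A)\<^sup>-\<^sup>1 A\<^sup>T\<close>.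
\<close>

section \<open>Algebra of differences, transposes and inverses\<close>

lemma matrix_minus_distrib:
  fixes A B :: "real^'n^'m" and C D :: "real^'p^'n"
  shows "(A - B) ** C = A ** C - B ** C" and "A ** (C - D) = A ** C - A ** D"
  by (simp_all add: matrix_matrix_mult_def vec_eq_iff sum_subtractf algebra_simps)

lemma transpose_minus: "transpose (A - B) = transpose A - transpose (B :: real^'n^'m)"
  by (simp add: transpose_def vec_eq_iff)

lemma matrix_inv_cancel:
  fixes P :: "real^'n^'n" and C :: "real^'n^'m" and D :: "real^'m^'n"
  assumes "invertible P"
  shows "P ** matrix_inv P = mat 1" "matrix_inv P ** P = mat 1"
    "C ** P ** matrix_inv P = C" "C ** matrix_inv P ** P = C"
    "P ** (matrix_inv P ** D) = D" "matrix_inv P ** (P ** D) = D"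
proof -
  show *: "P ** matrix_inv P = mat 1" "matrix_inv P ** P = mat 1"
    unfolding matrix_inv_def using assms[unfolded invertible_def, THEN someI_ex] by auto
  show "C ** P ** matrix_inv P = C" "C ** matrix_inv P ** P = C"
    by (simp_all add: matrix_mul_assoc[symmetric] *)
  show "P ** (matrix_inv P ** D) = D" "matrix_inv P ** (P ** D) = D"
    by (simp_all add: matrix_mul_assoc *)
qed

text \<open>A one-sided inverse of a square matrix is two-sided, so a single product identifies the
  inverse.\<close>

lemma matrix_inv_unique:
  fixes P Q :: "real^'n^'n"
  assumes "P ** Q = mat 1"
  shows "matrix_inv P = Q"
proof -
  have "invertible P"
    using assms invertible_right_inverse by blast
  then have "matrix_inv P ** (P ** Q) = Q"
    by (rule matrix_inv_cancel)
  then show ?thesis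
    by (simp add: assms)
qed

lemma matrix_inv_matrix_inv:
  fixes P :: "real^'n^'n"
  assumes "invertible P"
  shows "matrix_inv (matrix_inv P) = P"
  by (rule matrix_inv_unique) (rule matrix_inv_cancel(2)[OF assms])

lemma transpose_matrix_inv_sym:
  fixes P :: "real^'n^'n"
  assumes "invertible P" and "transpose P = P"
  shows "transpose (matrix_inv P) = matrix_inv P"
proof -
  have "P ** transpose (matrix_inv P) = transpose (matrix_inv P ** P)"
    by (simp add: matrix_transpose_mul assms(2))
  also have "\<dots> = mat 1"
    by (simp add: matrix_inv_cancel[OF assms(1)] transpose_mat)
  finally show ?thesis
    by (rule matrix_inv_unique[symmetric])
qed

section \<open>Semidefinite matrices and congruences\<close>

text \<open>The quadratic form of the congruence at \<open>v\<close> is the form of \<open>P\<close>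
  at \<open>transpose N *v v\<close>.\<close>

lemma pos_semidef_congruence:
  fixes P :: "real^'n^'n" and N :: "real^'n^'m"
  assumes "pos_semidef P"
  shows "pos_semidef (N ** P ** transpose N)"
proof -
  have "v \<bullet> ((N ** P ** transpose N) *v v) = (transpose N *v v) \<bullet> (P *v (transpose N *v v))" for v
    by (simp add: matrix_vector_mul_assoc[symmetric] dot_lmul_matrix[symmetric])
  with assms show ?thesis
    by (simp add: pos_semidef_def sym_matrix_def matrix_transpose_mul matrix_mul_assoc)
qed

lemma neg_semidef_uminus:
  assumes "pos_semidef (- P)"
  shows "neg_semidef P"
proof -
  have "(- P) *v v = - (P *v v)" for v
    by (simp add: matrix_vector_mult_def vec_eq_iff sum_negf)
  moreover have "transpose (- P) = - transpose P"
    by (simp add: transpose_def vec_eq_iff)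
  ultimately show ?thesis
    using assms by (simp add: pos_semidef_def neg_semidef_def sym_matrix_def)
qed

text \<open>A zero of the form minimises it. If \<open>P *v x\<close> were nonzero, a small move
  from \<open>x\<close> against this gradient direction would make the form negative.\<close>

lemma pos_semidef_kernel:
  fixes P :: "real^'n^'n"
  assumes "pos_semidef P" and zero: "x \<bullet> (P *v x) = 0"
  shows "P *v x = 0"
proof (rule ccontr)
  assume "P *v x \<noteq> 0"
  define y where "y = P *v x"
  define s where "s = y \<bullet> y"
  define q where "q = y \<bullet> (P *v y)"
  have "s > 0"
    using \<open>P *v x \<noteq> 0\<close> by (simp add: s_def y_def)
  have "q \<ge> 0"
    using assms(1) by (simp add: q_def pos_semidef_def)
  \<comment> \<open>The form at \<open>x - t *\<^sub>R y\<close> is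
    \<open>t\<^sup>2 * q - 2 * t * s\<close>, negative whenever \<open>t > 0\<close> and
    \<open>t * q < 2 * s\<close>. The denominator \<open>1 + q\<close> ensures
    \<open>t * q \<le> s\<close> and also covers \<open>q = 0\<close>.\<close>
  define t where "t = s / (1 + q)"
  have sym: "transpose P = P"
    using assms(1) by (simp add: pos_semidef_def sym_matrix_def)
  have xPy: "x \<bullet> (P *v y) = s"
    using dot_lmul_matrix[of x P y] sym by (metis s_def transpose_matrix_vector y_def)
  have "(x - t *\<^sub>R y) \<bullet> (P *v (x - t *\<^sub>R y)) = t\<^sup>2 * q - 2 * t * s"
    using zero xPy
    by (simp add: matrix_vector_mult_diff_distrib matrix_vector_mult_scaleR inner_diff_left
        inner_diff_right power2_eq_square q_def s_def algebra_simps flip: y_def)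
  then have "0 \<le> t\<^sup>2 * q - 2 * t * s"
    using assms(1) by (metis pos_semidef_def)
  moreover have "t > 0"
    using \<open>s > 0\<close> \<open>q \<ge> 0\<close> by (simp add: t_def)
  moreover have "t\<^sup>2 * q - 2 * t * s = t * (t * q - 2 * s)"
    by (simp add: power2_eq_square algebra_simps)
  ultimately have "2 * s \<le> t * q"
    by (simp add: zero_le_mult_iff)
  also have "t * q \<le> t * (1 + q)"
    using \<open>t > 0\<close> by (simp add: algebra_simps)
  also have "\<dots> = s"
    using \<open>q \<ge> 0\<close> by (simp add: t_def)
  finally show False
    using \<open>s > 0\<close> by simp
qed

text \<open>For \<open>x\<close> in the kernel, the form of \<open>P\<close> vanishes at
  \<open>A *v x\<close>, so \<open>P *v (A *v x) = 0\<close> by \<open>pos_semidef_kernel\<close>.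
  Invertibility of \<open>P\<close> then gives \<open>A *v x = 0\<close>, and that of the Gram
  matrix gives \<open>x = 0\<close>. Both \<Xi> and its inverse are later taken for
  \<open>P\<close>.\<close>

lemma invertible_congruence:
  fixes P :: "real^'n^'n" and A :: "real^'p^'n"
  assumes "pos_semidef P" and "invertible P" and gram: "invertible (transpose A ** A)"
  shows "invertible (transpose A ** P ** A)"
proof -
  have "x = 0" if "(transpose A ** P ** A) *v x = 0" for x
  proof -
    have "0 = x \<bullet> ((transpose A ** P ** A) *v x)"
      by (simp add: that)
    also have "\<dots> = (A *v x) \<bullet> (P *v (A *v x))"
      by (simp add: matrix_vector_mul_assoc[symmetric] dot_lmul_matrix[of x, symmetric]
          del: transpose_matrix_vector)
    finally have "P *v (A *v x) = 0"
      using assms(1) pos_semidef_kernel by metis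
    then have "A *v x = 0"
      by (metis assms(2) matrix_inv_cancel(2) matrix_vector_mul_assoc matrix_vector_mul_lid
          matrix_vector_mult_0_right)
    then have "(transpose A ** A) *v x = 0"
      by (simp add: matrix_vector_mul_assoc[symmetric])
    then show ?thesis
      by (metis gram matrix_inv_cancel(2) matrix_vector_mul_assoc matrix_vector_mul_lid
          matrix_vector_mult_0_right)
  qed
  then show ?thesis
    using invertible_left_inverse matrix_left_invertible_ker by blast
qed

text \<open>The inverse is itself a congruence of \<open>P\<close>, with the symmetric matrix
  \<open>matrix_inv P\<close> as \<open>N\<close>.\<close>

lemma pos_semidef_matrix_inv:
  fixes P :: "real^'n^'n"
  assumes "pos_semidef P" and "invertible P"
  shows "pos_semidef (matrix_inv P)"
proof -
  have "transpose (matrix_inv P) = matrix_inv P"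
    using assms by (simp add: transpose_matrix_inv_sym pos_semidef_def sym_matrix_def)
  with pos_semidef_congruence[OF assms(1), of "matrix_inv P"] show ?thesis
    by (simp add: matrix_inv_cancel[OF assms(2)])
qed

section \<open>Second moment matrices\<close>

text \<open>
  If the second moments are infinite, the Bochner integral is \<open>0\<close> by convention, which is positive
  semidefinite as well.
\<close>

lemma pos_semidef_second_moment_matrix:
  fixes X :: "'w \<Rightarrow> real^'n"
  shows "pos_semidef (second_moment_matrix M X)"
proof (cases "integrable M (\<lambda>\<omega>. outer (X \<omega>) (X \<omega>))")
  case True
  \<comment> \<open>Linear maps on a finite-dimensional space are bounded, so they commute with the
    Bochner integral; the quadratic form below is treated in the same way.\<close>
  have "transpose (\<integral>\<omega>. outer (X \<omega>) (X \<omega>) \<partial>M) = (\<integral>\<omega>. transpose (outer (X \<omega>) (X \<omega>)) \<partial>M)"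
    by (rule integral_bounded_linear[OF _ True, symmetric])
      (simp add: linear_conv_bounded_linear[symmetric] linear_iff transpose_def vec_eq_iff)
  moreover have "transpose (outer u u) = outer u u" for u :: "real^'n"
    by (simp add: transpose_def outer_def mult.commute)
  moreover have "0 \<le> v \<bullet> ((\<integral>\<omega>. outer (X \<omega>) (X \<omega>) \<partial>M) *v v)" for v
  proof -
    have "v \<bullet> ((\<integral>\<omega>. outer (X \<omega>) (X \<omega>) \<partial>M) *v v) = (\<integral>\<omega>. v \<bullet> (outer (X \<omega>) (X \<omega>) *v v) \<partial>M)"
      by (rule integral_bounded_linear[OF _ True, symmetric])
        (simp add: linear_conv_bounded_linear[symmetric] linear_iff inner_add_right
          matrix_vector_mult_add_rdistrib scaleR_matrix_vector_assoc[symmetric])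
    also have "\<dots> = (\<integral>\<omega>. (X \<omega> \<bullet> v)\<^sup>2 \<partial>M)"
      by (simp add: outer_def matrix_vector_mult_def inner_vec_def power2_eq_square
          sum_product sum_distrib_left mult_ac)
    finally show ?thesis
      by simp
  qed
  ultimately show ?thesis
    by (simp add: second_moment_matrix_def pos_semidef_def sym_matrix_def)
next
  case False
  then show ?thesis
    by (simp add: second_moment_matrix_def not_integrable_integral_eq pos_semidef_def
        sym_matrix_def transpose_def vec_eq_iff)
qed

section \<open>Comparison of the two variances and of their inverses\<close>

text \<open>With the true covariance in the contrast, the middle factor collapses to
  \<open>transpose A ** matrix_inv \<Xi> ** A\<close> and cancels one of the outer inverses.\<close>

lemma minimum_contrast_variance_same:
  fixes A :: "real^'p^'n" and \<Xi> :: "real^'n^'n"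
  assumes "pos_semidef \<Xi>" and "invertible \<Xi>" and "invertible (transpose A ** A)"
  shows "minimum_contrast_variance A \<Xi> \<Xi> = matrix_inv (transpose A ** matrix_inv \<Xi> ** A)"
proof -
  have "invertible (matrix_inv \<Xi>)"
    using matrix_inv_cancel[OF assms(2)] invertible_def by blast
  then have "invertible (transpose A ** matrix_inv \<Xi> ** A)"
    using assms by (intro invertible_congruence pos_semidef_matrix_inv)
  then show ?thesis
    by (simp add: minimum_contrast_variance_def matrix_inv_cancel assms(2))
qed

text \<open>Both terms of \<open>N\<close> are left inverses of \<open>A\<close>. The minimum
  contrast term has the same \<Xi>-covariance \<open>J\<close> with either of them, as in the
  Gauss-Markov theorem.\<close>

lemma variance_difference_pos_semidef:
  fixes A :: "real^'p^'n" and \<Xi> :: "real^'n^'n"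
  assumes psd: "pos_semidef \<Xi>" and inv: "invertible \<Xi>" and gram: "invertible (transpose A ** A)"
  shows "pos_semidef (trajectory_fitting_variance A \<Xi> -
           matrix_inv (transpose A ** matrix_inv \<Xi> ** A))"
proof -
  define G where "G = matrix_inv (transpose A ** A)"
  define R where "R = matrix_inv \<Xi>"
  define J where "J = matrix_inv (transpose A ** R ** A)"
  define N where "N = G ** transpose A - J ** transpose A ** R"
  have sym: "transpose \<Xi> = \<Xi>"
    using psd by (simp add: pos_semidef_def sym_matrix_def)
  have R: "transpose R = R" "R ** \<Xi> = mat 1" "\<Xi> ** R = mat 1"
    using matrix_inv_cancel[OF inv] transpose_matrix_inv_sym[OF inv sym] by (simp_all add: R_def)
  have invJ: "invertible (transpose A ** R ** A)"
    using R gram psd inv invertible_def[of R]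
    by (intro invertible_congruence) (auto simp: R_def pos_semidef_matrix_inv)
  have J: "transpose J = J" "J ** (transpose A ** R ** A) = mat 1"
    using matrix_inv_cancel[OF invJ] transpose_matrix_inv_sym[OF invJ] R
    by (simp_all add: J_def matrix_transpose_mul matrix_mul_assoc)
  have G: "transpose G = G" "G ** (transpose A ** A) = mat 1" "(transpose A ** A) ** G = mat 1"
    using matrix_inv_cancel[OF gram] transpose_matrix_inv_sym[OF gram]
    by (simp_all add: G_def matrix_transpose_mul)
  have cancel: "C ** R ** \<Xi> = C" "C ** \<Xi> ** R = C" for C :: "real^'n^'p"
    by (simp_all add: R flip: matrix_mul_assoc)
  \<comment> \<open>Expanding \<open>N ** \<Xi> ** transpose N\<close> gives two mixed terms with
    sign minus and one pure \<open>J\<close> term with sign plus. Each equals \<open>J\<close> up to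
    sign, which leaves \<open>- J\<close>.\<close>
  have cross: "J ** transpose A ** A ** G = J" "G ** transpose A ** A ** J = J"
    "J ** transpose A ** R ** A ** J = J"
  proof -
    have "J ** transpose A ** A ** G = J ** (transpose A ** A ** G)"
      by (simp only: matrix_mul_assoc)
    then show "J ** transpose A ** A ** G = J"
      by (simp add: G)
  qed (use J(2) G(2) in \<open>simp_all add: matrix_mul_assoc\<close>)
  have "N ** \<Xi> ** transpose N =
      G ** (transpose A ** \<Xi> ** A) ** G - J"
    unfolding N_def
    by (simp add: cancel cross matrix_minus_distrib transpose_minus matrix_transpose_mul R J G
        matrix_mul_assoc)
  with pos_semidef_congruence[OF psd, of N] show ?thesis
    by (simp add: trajectory_fitting_variance_def G_def J_def R_def)
qed

text \<open>This is shown directly, without the fact that inversion reverses the order of positive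
  definite matrices. The coefficient \<open>D ** K\<close> makes \<open>N\<close> the residual of
  projecting \<open>transpose A ** R\<close> onto multiples of \<open>transpose A\<close> in the
  \<Xi>-inner product.\<close>

lemma inverse_variance_difference_neg_semidef:
  fixes A :: "real^'p^'n" and \<Xi> :: "real^'n^'n"
  assumes psd: "pos_semidef \<Xi>" and inv: "invertible \<Xi>" and gram: "invertible (transpose A ** A)"
  shows "neg_semidef (matrix_inv (trajectory_fitting_variance A \<Xi>) -
           transpose A ** matrix_inv \<Xi> ** A)"
proof -
  define D where "D = transpose A ** A"
  define R where "R = matrix_inv \<Xi>"
  define K where "K = matrix_inv (transpose A ** \<Xi> ** A)"
  define N where "N = transpose A ** R - D ** K ** transpose A"
  have sym: "transpose \<Xi> = \<Xi>"
    using psd by (simp add: pos_semidef_def sym_matrix_def)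
  have R: "transpose R = R" "R ** \<Xi> = mat 1" "\<Xi> ** R = mat 1"
    using matrix_inv_cancel[OF inv] transpose_matrix_inv_sym[OF inv sym] by (simp_all add: R_def)
  have invK: "invertible (transpose A ** \<Xi> ** A)"
    by (rule invertible_congruence[OF psd inv gram])
  have K: "transpose K = K" "K ** (transpose A ** \<Xi> ** A) = mat 1"
    "(transpose A ** \<Xi> ** A) ** K = mat 1"
    using matrix_inv_cancel[OF invK] transpose_matrix_inv_sym[OF invK] sym
    by (simp_all add: K_def matrix_transpose_mul matrix_mul_assoc)
  have D: "transpose D = D" "matrix_inv D ** D = mat 1" "D ** matrix_inv D = mat 1"
    using matrix_inv_cancel[OF gram] by (simp_all add: D_def matrix_transpose_mul)
  have "matrix_inv (trajectory_fitting_variance A \<Xi>) = D ** K ** D"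
  proof (rule matrix_inv_unique)
    have "trajectory_fitting_variance A \<Xi> ** (D ** K ** D) =
        matrix_inv D ** ((transpose A ** \<Xi> ** A) ** ((matrix_inv D ** D) ** K)) ** D"
      by (simp add: trajectory_fitting_variance_def D_def matrix_mul_assoc)
    then show "trajectory_fitting_variance A \<Xi> ** (D ** K ** D) = mat 1"
      by (simp add: D K)
  qed
  moreover have "N ** \<Xi> ** transpose N = transpose A ** R ** A - D ** K ** D"
  proof -
    have "transpose A ** R ** \<Xi> ** transpose N = transpose A ** R ** A - D ** K ** D"
    proof -
      have "transpose A ** R ** \<Xi> = transpose A"
        by (simp add: R flip: matrix_mul_assoc)
      then show ?thesis
        unfolding N_def
        by (simp add: matrix_minus_distrib transpose_minus matrix_transpose_mul R K D)
          (simp add: D_def matrix_mul_assoc)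
    qed
    \<comment> \<open>Orthogonality of the residual: both terms of \<open>transpose N\<close>
      contribute \<open>D\<close>, with opposite signs. Hence only the first term of the left factor
      \<open>N\<close> survives in the congruence.\<close>
    moreover have "transpose A ** \<Xi> ** transpose N = 0"
    proof -
      have "transpose A ** \<Xi> ** (R ** A) = D"
        by (simp add: D_def flip: matrix_mul_assoc) (simp add: R matrix_mul_assoc)
      moreover have "transpose A ** \<Xi> ** (A ** (K ** D)) = D"
        using K(3) by (simp add: matrix_mul_assoc)
      ultimately show ?thesis
        unfolding N_def
        by (simp add: matrix_minus_distrib transpose_minus matrix_transpose_mul R K D)
    qed
    then have "D ** K ** transpose A ** \<Xi> ** transpose N = 0"
      by (simp flip: matrix_mul_assoc)
    moreover have "N ** \<Xi> ** transpose N =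
        transpose A ** R ** \<Xi> ** transpose N - D ** K ** transpose A ** \<Xi> ** transpose N"
      unfolding N_def by (simp only: matrix_minus_distrib)
    ultimately show ?thesis
      by simp
  qed
  ultimately show ?thesis
    using pos_semidef_congruence[OF psd, of N] by (intro neg_semidef_uminus) (simp add: R_def)
qed

text \<open>Existence of the inverses is expressed by invertibility of the Gram matrix and of \<Xi>;
  the remaining inverses exist as a consequence. The two semidefiniteness claims are proved
  independently of each other.\<close>

theorem theorem10:
  fixes T lam H :: real
    and \<Theta> :: "(real^'p) set"
    and c :: "real^'p \<Rightarrow> real^'m \<Rightarrow> real^'y \<Rightarrow> real^'m"
    and \<sigma> :: "real^'y \<Rightarrow> real^'v^'m"
    and f :: "real^'y \<Rightarrow> real^'y"
    and \<tau> :: "real^'y \<Rightarrow> real^'l^'y"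
    and x\<^sub>0 :: "real^'m"
    and \<mu> :: "(real^'y) measure"
    and Xbar :: "real^'p \<Rightarrow> real \<Rightarrow> real^'m"
    and \<Phi> :: "real^'p \<Rightarrow> real^'m \<Rightarrow> real^'y \<Rightarrow> real^'m"
    and Z :: "real^'p \<Rightarrow> real \<Rightarrow> real \<Rightarrow> real^'m^'m"
    and \<theta> :: "real^'p"
    and M :: "'w measure"
    and B :: "real \<Rightarrow> 'w \<Rightarrow> real^'m"
    and W :: "real \<Rightarrow> 'w \<Rightarrow> real^'v"
    and \<xi> :: "real \<Rightarrow> 'w \<Rightarrow> real^'m"
    and n :: nat
    and label :: "'k::finite \<Rightarrow> nat"
    and A :: "real^'p^('k \<times> 'm)"
    and \<Xi> :: "real^('k \<times> 'm)^('k \<times> 'm)"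
  assumes "0 < T" and "0 \<le> lam"
    and "open \<Theta>" and "bounded \<Theta>" and "convex \<Theta>"
    and "drift_assumptions \<Theta> c"
    and "sigma_assumptions \<sigma>"
    and "fast_assumptions f \<tau>"
    and "invariant_prob f \<tau> \<mu>" and "\<And>\<nu>. invariant_prob f \<tau> \<nu> \<Longrightarrow> \<nu> = \<mu>"
    and "\<And>\<theta>. \<theta> \<in> \<Theta> \<Longrightarrow> integral_solution T (c_bar \<mu> c \<theta>) x\<^sub>0 (Xbar \<theta>)"
    and "\<And>\<theta> x. \<theta> \<in> \<Theta> \<Longrightarrow>
           poisson_solution f \<tau> \<mu> (\<lambda>y. c \<theta> x y - c_bar \<mu> c \<theta> x) (\<Phi> \<theta> x)"
    and "\<And>\<theta> x \<Psi>. \<theta> \<in> \<Theta> \<Longrightarrow>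
           poisson_solution f \<tau> \<mu> (\<lambda>y. c \<theta> x y - c_bar \<mu> c \<theta> x) \<Psi> \<Longrightarrow> \<Psi> = \<Phi> \<theta> x"
    and "\<And>\<theta>. \<theta> \<in> \<Theta> \<Longrightarrow> fundamental_matrix T (c_bar \<mu> c \<theta>) (Xbar \<theta>) (Z \<theta>)"
    and "\<theta> \<in> \<Theta>" and "1/2 < H" and "H < 1"
    and "prob_space M"
    and "brownian_motion M T B"
    and "fractional_brownian_motion M T H W"
    and "independent_processes M T B W"
    and "limit_process M T lam B W (Z \<theta>) (\<lambda>s. Sigma_Phi \<mu> \<tau> (\<Phi> \<theta>) (Xbar \<theta> s))
           (sigma_bar \<mu> \<sigma>) \<xi>"
    and "bij_betw label (UNIV :: 'k set) {1..n}"
    and "A = stack label (\<lambda>k. jacobian (\<lambda>\<theta>. Xbar \<theta> (T * real k / real n)) (at \<theta>))"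
    and "\<Xi> = second_moment_matrix M (\<lambda>\<omega>. stack label (\<lambda>k. \<xi> (T * real k / real n) \<omega>))"
    and "invertible (transpose A ** A)" and "invertible \<Xi>"
  shows "pos_semidef (trajectory_fitting_variance A \<Xi> - minimum_contrast_variance A \<Xi> \<Xi>) \<and>
         neg_semidef (matrix_inv (trajectory_fitting_variance A \<Xi>) -
           matrix_inv (minimum_contrast_variance A \<Xi> \<Xi>)) \<and>
         minimum_contrast_variance A \<Xi> \<Xi> =
           matrix_inv (transpose A ** matrix_inv \<Xi> ** A)"
proof -
  have psd: "pos_semidef \<Xi>"
    using assms(25) by (simp add: pos_semidef_second_moment_matrix)
  have gram: "invertible (transpose A ** A)" and inv: "invertible \<Xi>"
    using assms(26,27) by simp_all
  have "invertible (matrix_inv \<Xi>)"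
    using matrix_inv_cancel[OF inv] invertible_def by blast
  \<comment> \<open>This allows \<open>matrix_inv_matrix_inv\<close> to turn the inverse of the
    minimum contrast variance into \<open>transpose A ** matrix_inv \<Xi> ** A\<close>.\<close>
  then have "invertible (transpose A ** matrix_inv \<Xi> ** A)"
    by (intro invertible_congruence pos_semidef_matrix_inv psd inv gram)
  then show ?thesis
    using variance_difference_pos_semidef[OF psd inv gram]
      inverse_variance_difference_neg_semidef[OF psd inv gram]
    by (simp add: minimum_contrast_variance_same[OF psd inv gram] matrix_inv_matrix_inv)
qed

end
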